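(* Let $q\ge 1$ be an integer and let $T$ be an infinite $(q+1)$-homogeneous tree rooted at $o$. For $0<p\le\infty$, $\mathbb{T}_p$ is not separable.
   Context: A $(q+1)$-homogeneous tree is a connected graph without cycles in which every vertex has exactly $q+1$ neighbours; rooted means that a vertex $o$ (the root) is singled out. For a vertex $v$, $|v|$ is the number of edges in the unique path from $o$ to $v$; for $n\ge1$ there are $(q+1)q^{n-1}$ vertices with $|v|=n$. Functions on $T$ are functions on its vertices. $\mathbb{N}=\{1,2,\dots\}$, $\mathbb{N}_0=\mathbb{N}\cup\{0\}$. For $f\colon T\to\mathbb{C}$ and $n\in\mathbb{N}$, $M_p(n,f)=\left(\frac{1}{(q+1)q^{n-1}}\sum_{|v|=n}|f(v)|^p\right)^{1/p}$ if $0<p<\infty$, $M_\infty(n,f)=\max_{|v|=n}|f(v)|$, and $M_p(0,f)=|f(o)|$ for all $p\in(0,\infty]$. Put $\|f\|_p=\sup_{n\in\mathbb{N}_0}M_p(n,f)$ and $\mathbb{T}_p=\{f\colon T\to\mathbb{C}:\|f\|_p<\infty\}$. The topology is that determined by $\|\cdot\|_p$: $f_k\to f$ means $\|f_k-f\|_p\to0$ (metric $\|f-g\|_p$ for $p\ge1$, and $\|f-g\|_p^p$ for $0<p<1$). Separable means having a countable dense subset. *)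

theory Defs
  imports "HOL-Analysis.Analysis"
begin

section \<open>Simple graphs and homogeneous trees\<close>

locale simple_graph =
  fixes V :: "'v set" and E :: "'v set set"
  assumes edges: "e \<in> E \<Longrightarrow> \<exists>u\<in>V. \<exists>v\<in>V. u \<noteq> v \<and> e = {u, v}"
begin

definition adj :: "'v \<Rightarrow> 'v \<Rightarrow> bool" where
  "adj u v \<longleftrightarrow> {u, v} \<in> E"

text \<open>Walks are given by their nonempty list of vertices, so a walk \<open>xs\<close> has
  \<open>length xs - 1\<close> edges.\<close>

definition walk_between :: "'v \<Rightarrow> 'v list \<Rightarrow> 'v \<Rightarrow> bool" where
  "walk_between u xs v \<longleftrightarrow>
     xs \<noteq> [] \<and> set xs \<subseteq> V \<and> successively adj xs \<and> hd xs = u \<and> last xs = v"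

definition path_between :: "'v \<Rightarrow> 'v list \<Rightarrow> 'v \<Rightarrow> bool" where
  "path_between u xs v \<longleftrightarrow> walk_between u xs v \<and> distinct xs"

definition connected_graph :: bool where
  "connected_graph \<longleftrightarrow> V \<noteq> {} \<and> (\<forall>u\<in>V. \<forall>v\<in>V. \<exists>xs. walk_between u xs v)"

text \<open>The closing vertex of a cycle is not repeated in the list.\<close>

definition is_cycle :: "'v list \<Rightarrow> bool" where
  "is_cycle xs \<longleftrightarrow>
     length xs \<ge> 3 \<and> set xs \<subseteq> V \<and> distinct xs \<and> successively adj xs \<and> adj (last xs) (hd xs)"

definition neighbours :: "'v \<Rightarrow> 'v set" where
  "neighbours v = {w \<in> V. adj v w}"

end

locale rooted_homogeneous_tree = simple_graph V E
  for V :: "'v set" and E :: "'v set set" +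
  fixes r :: 'v and q :: nat
  assumes connected: "connected_graph"
    and acyclic: "\<not> is_cycle xs"
    and homogeneous: "v \<in> V \<Longrightarrow> finite (neighbours v) \<and> card (neighbours v) = q + 1"
    and root: "r \<in> V"
begin

definition level :: "'v \<Rightarrow> nat" where
  "level v = length (THE xs. path_between r xs v) - 1"

definition sphere_at :: "nat \<Rightarrow> 'v set" where
  "sphere_at n = {v \<in> V. level v = n}"


section \<open>The spaces of functions with bounded means\<close>

text \<open>The exponent ranges over \<open>ennreal\<close>, with \<open>p = \<infinity>\<close> allowed.\<close>

definition mean :: "ennreal \<Rightarrow> nat \<Rightarrow> ('v \<Rightarrow> complex) \<Rightarrow> real" where
  "mean p n f =
     (if n = 0 then cmod (f r)
      else if p = \<infinity> then Max ((\<lambda>v. cmod (f v)) ` sphere_at n)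
      else (1 / ((real q + 1) * real q ^ (n - 1)) *
              (\<Sum>v\<in>sphere_at n. cmod (f v) powr enn2real p)) powr (1 / enn2real p))"

definition Tnorm :: "ennreal \<Rightarrow> ('v \<Rightarrow> complex) \<Rightarrow> ennreal" where
  "Tnorm p f = (SUP n. ennreal (mean p n f))"

text \<open>A function on the tree is represented by a total function that is
  \<open>undefined\<close> outside \<open>V\<close>, so that functions agreeing on \<open>V\<close> are equal.
  The quantity \<open>Tnorm\<close> only looks at values on \<open>V\<close>; hence pointwise differences
  need no restriction to \<open>V\<close>.\<close>

definition Tspace :: "ennreal \<Rightarrow> ('v \<Rightarrow> complex) set" where
  "Tspace p = {f \<in> extensional V. Tnorm p f < \<infinity>}"

definition Tdist :: "ennreal \<Rightarrow> ('v \<Rightarrow> complex) \<Rightarrow> ('v \<Rightarrow> complex) \<Rightarrow> real" where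
  "Tdist p f g =
     (if p \<ge> 1 then enn2real (Tnorm p (\<lambda>v. f v - g v))
      else enn2real (Tnorm p (\<lambda>v. f v - g v)) powr enn2real p)"

definition Ttopology :: "ennreal \<Rightarrow> ('v \<Rightarrow> complex) topology" where
  "Ttopology p = Metric_space.mtopology (Tspace p) (Tdist p)"

end

end

theory Submission
  imports Defs
begin

text \<open>The functions that are constant on each sphere, with values \<open>0\<close> or the value
  that makes the mean on that sphere equal to \<open>1\<close>, are indexed by the sets of levels:
  uncountably many elements of the space at mutual distance at least \<open>1\<close>. Because of the
  normalisation only finiteness and nonemptiness of the spheres matter, not their
  cardinalities.\<close>

section \<open>Power inequalities\<close>

text \<open>A fraction \<open>z\<close> in [0,1] satisfies \<open>z \<le> z powr s\<close> because
  \<open>s \<le> 1\<close>. Apply this to the fractions \<open>x / (x + y)\<close> and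
  \<open>y / (x + y)\<close>, which sum to 1, and scale back.\<close>

lemma powr_subadditive:
  fixes x y s :: real
  assumes "0 \<le> x" "0 \<le> y" "0 < s" "s \<le> 1"
  shows "(x + y) powr s \<le> x powr s + y powr s"
proof (cases "x + y = 0")
  case True
  then show ?thesis using assms by simp
next
  case False
  then have pos: "0 < x + y" using assms by simp
  have frac: "z / (x + y) \<le> (z / (x + y)) powr s" if "0 \<le> z" "z \<le> x + y" for z
    using powr_mono'[of s 1 "z / (x + y)"] that assms pos by simp
  have "(x + y) powr s = (x + y) powr s * (x / (x + y) + y / (x + y))"
    using pos by (simp flip: add_divide_distrib)
  also have "\<dots> \<le> (x + y) powr s * ((x / (x + y)) powr s + (y / (x + y)) powr s)"
    using frac assms by (intro mult_left_mono add_mono) auto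
  also have "\<dots> = x powr s + y powr s"
    using pos assms by (simp add: powr_divide distrib_left)
  finally show ?thesis .
qed

text \<open>Two positive points are covered by \<open>powr_convex\<close>. If one point is 0, the
  claim reduces to \<open>c powr p \<le> c\<close> for \<open>0 < c < 1\<close>.\<close>

lemma powr_convex_nonneg:
  fixes p :: real
  assumes "1 \<le> p"
  shows "convex_on {0..} (\<lambda>x. x powr p)"
proof (rule convex_onI)
  fix t x y :: real
  assume t: "0 < t" "t < 1" and xy: "x \<in> {0..}" "y \<in> {0..}"
  have contract: "(c * z) powr p \<le> c * z powr p" if "0 < c" "c < 1" "0 \<le> z" for c z :: real
    using powr_mono'[of 1 p c] that assms by (simp add: powr_mult mult_right_mono)
  show "((1 - t) *\<^sub>R x + t *\<^sub>R y) powr p \<le> (1 - t) * x powr p + t * y powr p"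
  proof (cases "x = 0 \<or> y = 0")
    case True
    then show ?thesis using contract[of t y] contract[of "1 - t" x] t xy assms by auto
  next
    case False
    then show ?thesis
      using convex_onD[OF powr_convex[OF assms], of t x y] t xy by auto
  qed
qed simp

text \<open>After division by the p-norms \<open>A\<close> and \<open>B\<close>, the quotient
  \<open>(a i + b i) / (A + B)\<close> is a convex combination of \<open>a i / A\<close> and
  \<open>b i / B\<close> with weights \<open>A / (A + B)\<close> and \<open>B / (A + B)\<close>.
  Convexity of the p-th power, summed over \<open>S\<close>, gives the bound.\<close>

lemma Minkowski_sum:
  fixes a b :: "'a \<Rightarrow> real" and p :: real
  assumes "finite S" "1 \<le> p" and a: "\<And>i. i \<in> S \<Longrightarrow> 0 \<le> a i" and b: "\<And>i. i \<in> S \<Longrightarrow> 0 \<le> b i"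
  shows "(\<Sum>i\<in>S. (a i + b i) powr p) powr (1 / p)
         \<le> (\<Sum>i\<in>S. a i powr p) powr (1 / p) + (\<Sum>i\<in>S. b i powr p) powr (1 / p)"
proof -
  define A where "A = (\<Sum>i\<in>S. a i powr p) powr (1 / p)"
  define B where "B = (\<Sum>i\<in>S. b i powr p) powr (1 / p)"
  have AB: "A \<ge> 0" "B \<ge> 0" unfolding A_def B_def by auto
  have Ap: "A powr p = (\<Sum>i\<in>S. a i powr p)" and Bp: "B powr p = (\<Sum>i\<in>S. b i powr p)"
    unfolding A_def B_def using assms(2) by (simp_all add: powr_powr sum_nonneg)
  show ?thesis
  \<comment> \<open>The normalisation divides by \<open>A\<close> and \<open>B\<close>; if one of
    them is 0, the corresponding family vanishes on \<open>S\<close>.\<close>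
  proof (cases "A = 0 \<or> B = 0")
    case True
    then have "(\<forall>i\<in>S. a i = 0) \<or> (\<forall>i\<in>S. b i = 0)"
      unfolding A_def B_def using assms(1) by (auto simp: sum_nonneg_eq_0_iff)
    then show ?thesis
      using AB unfolding A_def B_def by auto
  next
    case False
    then have pos: "A > 0" "B > 0" using AB by auto
    define t where "t = B / (A + B)"
    have t: "0 \<le> t" "t \<le> 1" "1 - t = A / (A + B)" unfolding t_def using pos by (auto simp: field_simps)
    have "(a i + b i) powr p \<le> (A + B) powr p * ((1 - t) * (a i powr p / A powr p) + t * (b i powr p / B powr p))"
      if "i \<in> S" for i
    proof -
      have "a i + b i = (A + B) * ((1 - t) * (a i / A) + t * (b i / B))"
        unfolding t(3) unfolding t_def using pos by (simp add: distrib_left)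
      then have "(a i + b i) powr p = (A + B) powr p * ((1 - t) * (a i / A) + t * (b i / B)) powr p"
        using pos t a[OF that] b[OF that] by (simp only: powr_mult) 
      also have "\<dots> \<le> (A + B) powr p * ((1 - t) * (a i / A) powr p + t * (b i / B) powr p)"
        using convex_onD[OF powr_convex_nonneg[OF assms(2)], of t "a i / A" "b i / B"]
          t pos a[OF that] b[OF that] by (intro mult_left_mono) auto
      finally show ?thesis using pos a[OF that] b[OF that] by (simp add: powr_divide)
    qed
    then have "(\<Sum>i\<in>S. (a i + b i) powr p)
        \<le> (\<Sum>i\<in>S. (A + B) powr p * ((1 - t) * (a i powr p / A powr p) + t * (b i powr p / B powr p)))"
      by (rule sum_mono)
    also have "\<dots> = (A + B) powr p * ((1 - t) * (A powr p / A powr p) + t * (B powr p / B powr p))"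
      by (simp only: sum.distrib sum_distrib_left[symmetric] sum_divide_distrib[symmetric] Ap Bp)
    also have "\<dots> = (A + B) powr p"
      using pos by simp
    finally have "(\<Sum>i\<in>S. (a i + b i) powr p) powr (1 / p) \<le> ((A + B) powr p) powr (1 / p)"
      using assms(2) by (intro powr_mono2) (auto intro: sum_nonneg)
    also have "\<dots> = A + B"
      using pos assms(2) by (simp add: powr_powr)
    finally show ?thesis unfolding A_def B_def .
  qed
qed

section \<open>Separated families in metric spaces\<close>

text \<open>A dense set has a point within \<open>e / 2\<close> of every \<open>x i\<close>, and the
  separation makes the choice of such points injective. A countable dense set would therefore make
  the index type countable.\<close>

lemma (in Metric_space) separated_imp_not_separable:
  fixes x :: "'i \<Rightarrow> 'a"
  assumes "range x \<subseteq> M" "0 < e" and sep: "\<And>i j. i \<noteq> j \<Longrightarrow> e \<le> d (x i) (x j)"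
    and unc: "uncountable (UNIV :: 'i set)"
  shows "\<not> separable_space mtopology"
proof
  assume "separable_space mtopology"
  then obtain C where C: "countable C" "C \<subseteq> M" "mtopology closure_of C = M"
    unfolding separable_space_def by auto
  have "\<exists>c\<in>C. d (x i) c < e / 2" for i
  proof -
    have "x i \<in> mtopology closure_of C" using C assms(1) by blast
    then have "\<exists>c\<in>C. c \<in> mball (x i) (e / 2)"
      using half_gt_zero[OF \<open>0 < e\<close>] unfolding metric_closure_of by blast
    then show ?thesis by auto
  qed
  then obtain c where c: "\<And>i. c i \<in> C" "\<And>i. d (x i) (c i) < e / 2" by metis
  have "inj c"
  proof
    fix i j assume eq: "c i = c j"
    show "i = j"
    proof (rule ccontr)
      assume "i \<noteq> j"
      then have "e \<le> d (x i) (x j)" by (rule sep)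
      also have "\<dots> \<le> d (x i) (c i) + d (x j) (c i)"
        using triangle' assms(1) C c(1) by blast
      also have "\<dots> < e" using c(2)[of i] c(2)[of j] eq by simp
      finally show False by simp
    qed
  qed
  moreover have "countable (range c)"
    using c(1) by (intro countable_subset[OF _ C(1)]) auto
  ultimately show False using unc countable_image_inj_on[of c UNIV] by simp
qed

lemma uncountable_UNIV_nat_set: "uncountable (UNIV :: nat set set)"
proof
  assume "countable (UNIV :: nat set set)"
  then have "range (from_nat_into (UNIV :: nat set set)) = UNIV"
    by (rule range_from_nat_into[rotated]) simp
  then show False using Cantors_theorem[of UNIV] by (metis Pow_UNIV)
qed

section \<open>Paths and spheres in homogeneous trees\<close>

context simple_graph
begin

lemma adj_sym: "adj u v \<Longrightarrow> adj v u"
  unfolding adj_def by (simp add: insert_commute)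

text \<open>Induction on length: if a vertex \<open>y\<close> is repeated, the detour between two of
  its occurrences is cut out.\<close>

lemma walk_between_imp_path:
  assumes "walk_between u xs v"
  obtains ys where "path_between u ys v"
proof -
  have "\<exists>ys. path_between u ys v" using assms
  proof (induction xs rule: length_induct)
    case (1 xs)
    show ?case
    proof (cases "distinct xs")
      case True
      then show ?thesis using 1 unfolding path_between_def by blast
    next
      case False
      then obtain as y bs cs where xs: "xs = as @ [y] @ bs @ [y] @ cs"
        using not_distinct_decomp by blast
      have "successively adj (as @ [y] @ cs)"
        using "1.prems" successively_append_iff[of adj "as @ [y] @ bs" "[y] @ cs"]
          successively_append_iff[of adj as] unfolding walk_between_def xs
        by (simp add: successively_append_iff)
      moreover have "hd (as @ [y] @ cs) = hd xs" "last (as @ [y] @ cs) = last xs"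
        unfolding xs by (simp_all add: hd_append)
      ultimately have "walk_between u (as @ [y] @ cs) v"
        using "1.prems" unfolding walk_between_def by (simp add: xs)
      moreover have "length (as @ [y] @ cs) < length xs"
        by (simp add: xs)
      ultimately show ?thesis using "1.IH" by blast
    qed
  qed
  then show ?thesis using that by blast
qed

text \<open>The two paths are followed from their first divergence at \<open>u\<close> up to the first
  vertex where the second one meets the first one again.\<close>

lemma divergent_paths_imp_cycle:
  assumes "path_between u (u # x # xs) v" "path_between u (u # y # ys) v" "x \<noteq> y"
  obtains c where "is_cycle c"
proof -
  have "v = last (x # xs)" "v = last (y # ys)"
    using assms unfolding path_between_def walk_between_def by auto
  then have "\<exists>w\<in>set (y # ys). w \<in> set (x # xs)"
    using last_in_set[of "x # xs"] last_in_set[of "y # ys"] by (metis list.discI)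
  then obtain as w bs where ys: "y # ys = as @ w # bs" and w: "w \<in> set (x # xs)"
    and as: "\<forall>z\<in>set as. z \<notin> set (x # xs)"
    using split_list_first_prop[of "y # ys" "\<lambda>w. w \<in> set (x # xs)"] by blast
  obtain cs ds where xs: "x # xs = cs @ w # ds"
    using split_list[OF w] by blast
  have px: "path_between u (u # cs @ w # ds) v" and py: "path_between u (u # as @ w # bs) v"
    using assms xs ys by metis+
  \<comment> \<open>Out from \<open>u\<close> to \<open>w\<close> along the first path, then back
    along the second; the closing edge returns to \<open>u\<close>.\<close>
  let ?c = "(u # cs @ [w]) @ rev as"
  \<comment> \<open>If both were empty, then \<open>x = w = y\<close>. So some vertex besides
    \<open>u\<close> and \<open>w\<close> lies on the cycle.\<close>
  have "as \<noteq> [] \<or> cs \<noteq> []"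
    using assms(3) xs ys by auto
  then have len: "length ?c \<ge> 3"
    by (cases as; cases cs) auto
  have subV: "set ?c \<subseteq> V"
    using px py unfolding path_between_def walk_between_def by auto
  have dist: "distinct ?c"
    using px py as xs unfolding path_between_def by auto
  have outw: "successively adj (u # cs @ [w])"
    using px successively_append_iff[of adj "u # cs @ [w]" ds]
    unfolding path_between_def walk_between_def by simp
  have "successively adj (u # as @ [w])"
    using py successively_append_iff[of adj "u # as @ [w]" bs]
    unfolding path_between_def walk_between_def by simp
  then have "successively (\<lambda>a b. adj b a) (u # as @ [w])"
    by (rule successively_mono) (rule adj_sym)
  then have "successively adj (rev (u # as @ [w]))"
    by (simp only: successively_rev)
  then have inw: "successively adj ([w] @ rev as @ [u])"
    by simp
  have "last ?c = last (w # rev as)" by simp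
  moreover have "adj (last (w # rev as)) u"
    using inw successively_append_iff[of adj "w # rev as" "[u]"] by simp
  ultimately have closing: "adj (last ?c) (hd ?c)" by simp
  have "successively adj (w # rev as)"
    using inw successively_append_iff[of adj "w # rev as" "[u]"] by simp
  then have "successively adj ((u # cs) @ w # rev as)"
    using outw successively_append_iff[of adj "u # cs"] by simp
  then have "successively adj ?c" by simp
  with len subV dist closing have "is_cycle ?c"
    unfolding is_cycle_def by blast
  then show ?thesis by (rule that)
qed

text \<open>Both paths start at \<open>u\<close>, and without cycles their second vertices agree
  too, so the induction continues from there.\<close>

lemma acyclic_path_unique:
  assumes "\<And>c. \<not> is_cycle c" "path_between u xs v" "path_between u ys v"
  shows "xs = ys"
  using assms(2,3)
proof (induction xs arbitrary: u ys)
  case Nil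
  then show ?case unfolding path_between_def walk_between_def by simp
next
  case (Cons a xs)
  have a: "a = u" using Cons.prems unfolding path_between_def walk_between_def by simp
  obtain zs where ys: "ys = u # zs"
    using Cons.prems unfolding path_between_def walk_between_def by (cases ys) auto
  show ?case
  proof (cases "xs = [] \<or> zs = []")
    \<comment> \<open>If one path consists of \<open>u\<close> alone, then \<open>v = u\<close>, and
      distinctness keeps the other path from ending at \<open>u\<close> again.\<close>
    case True
    then show ?thesis
      using Cons.prems last_in_set[of xs] last_in_set[of zs]
      unfolding a ys path_between_def walk_between_def by (auto split: if_splits)
  next
    case False
    then obtain x xs' y zs' where e: "xs = x # xs'" "zs = y # zs'"
      by (meson list.exhaust)
    have "x = y"
      using divergent_paths_imp_cycle assms(1) Cons.prems unfolding a ys e by metis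
    then have "path_between x xs v" "path_between x zs v"
      using Cons.prems unfolding a ys e path_between_def walk_between_def by auto
    then show ?thesis using Cons.IH a ys by blast
  qed
qed

end

section \<open>Levels and spheres of the infinite tree\<close>

locale infinite_rooted_homogeneous_tree = rooted_homogeneous_tree V E r q
  for V :: "'v set" and E :: "'v set set" and r :: 'v and q :: nat +
  assumes q_ge_1: "q \<ge> 1" and infinite_V: "infinite V"
begin

text \<open>Uniqueness of paths lets any path from the root evaluate the definite description in
  \<open>level\<close>.\<close>

lemma level_eq:
  assumes "path_between r xs v"
  shows "level v = length xs - 1"
  using assms acyclic_path_unique[OF acyclic assms] unfolding level_def
  by (metis (mono_tags, lifting) the_equality)

lemma path_exists:
  assumes "v \<in> V"
  obtains xs where "path_between r xs v" "length xs = Suc (level v)"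
proof -
  obtain xs where xs: "path_between r xs v"
    using connected assms root walk_between_imp_path unfolding connected_graph_def by metis
  then have "xs \<noteq> []" unfolding path_between_def walk_between_def by simp
  with xs show ?thesis using that level_eq by (cases xs) auto
qed

lemma sphere_at_0: "sphere_at 0 = {r}"
proof -
  have "path_between r [r] r"
    unfolding path_between_def walk_between_def using root by simp
  then have "r \<in> sphere_at 0"
    using level_eq root unfolding sphere_at_def by fastforce
  moreover have "v = r" if "v \<in> sphere_at 0" for v
  proof -
    have "v \<in> V" "level v = 0" using that unfolding sphere_at_def by auto
    then obtain xs where "path_between r xs v" "length xs = Suc 0"
      using path_exists by metis
    then show ?thesis
      unfolding path_between_def walk_between_def by (auto simp: length_Suc_conv)
  qed
  ultimately show ?thesis by blast
qed

text \<open>Deleting the last vertex of the path to \<open>v\<close> leaves the path to its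
  predecessor, one level lower.\<close>

lemma sphere_at_Suc_parent:
  assumes "v \<in> sphere_at (Suc n)"
  obtains u where "u \<in> sphere_at n" "v \<in> neighbours u"
proof -
  have v: "v \<in> V" "level v = Suc n" using assms unfolding sphere_at_def by auto
  obtain xs where xs: "path_between r xs v" "length xs = Suc (Suc n)"
    using path_exists[OF v(1)] v(2) by metis
  then obtain ys where ys: "xs = ys @ [v]" "ys \<noteq> []"
    unfolding path_between_def walk_between_def
    by (metis append_butlast_last_id length_Cons length_append_singleton list.size(3) nat.inject nat.distinct(1))
  have p: "path_between r ys (last ys)" "adj (last ys) v"
    using xs(1) ys unfolding path_between_def walk_between_def
    by (auto simp: successively_append_iff)
  have "last ys \<in> V"
    using p(1) ys(2) last_in_set unfolding path_between_def walk_between_def by blast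
  then have "last ys \<in> sphere_at n" "v \<in> neighbours (last ys)"
    using level_eq[OF p(1)] xs(2) ys v p(2) unfolding sphere_at_def neighbours_def by auto
  then show ?thesis by (rule that)
qed

lemma finite_sphere_at: "finite (sphere_at n)"
proof (induction n)
  case 0
  then show ?case by (simp add: sphere_at_0)
next
  case (Suc n)
  have "sphere_at (Suc n) \<subseteq> (\<Union>u\<in>sphere_at n. neighbours u)"
    using sphere_at_Suc_parent by blast
  moreover have "finite (\<Union>u\<in>sphere_at n. neighbours u)"
    using Suc homogeneous unfolding sphere_at_def by auto
  ultimately show ?case by (rule finite_subset)
qed

text \<open>By \<open>sphere_at_Suc_parent\<close>, all spheres after an empty one are empty. Then
  \<open>V\<close> would be a finite union of finite spheres.\<close>

lemma sphere_at_nonempty: "sphere_at n \<noteq> {}"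
proof
  assume e: "sphere_at n = {}"
  have "sphere_at m = {}" if "n \<le> m" for m
    using that by (induction rule: dec_induct) (use e sphere_at_Suc_parent in blast)+
  then have "level v < n" if "v \<in> V" for v
    using that linorder_not_less unfolding sphere_at_def by blast
  then have "V \<subseteq> (\<Union>m<n. sphere_at m)"
    unfolding sphere_at_def by auto
  then show False
    using infinite_V finite_subset[of V] finite_sphere_at by simp
qed

section \<open>The metric and the separated family\<close>

text \<open>With \<open>s = min 1 p\<close> both cases of \<open>Tdist\<close> read \<open>\<parallel>f - g\<parallel> powr s\<close>, and
  the means raised to the power \<open>s\<close> are subadditive for every \<open>p\<close>.\<close>

definition gauge_exp :: "ennreal \<Rightarrow> real" where
  "gauge_exp p = (if p \<ge> 1 then 1 else enn2real p)"

lemma gauge_exp_bounds: "0 < p \<Longrightarrow> 0 < gauge_exp p" "gauge_exp p \<le> 1"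
proof -
  show "0 < gauge_exp p" if "0 < p"
    using that unfolding gauge_exp_def
    by (auto simp: enn2real_positive_iff not_le intro: order.strict_trans)
  show "gauge_exp p \<le> 1"
    unfolding gauge_exp_def using enn2real_mono[of p 1] by auto
qed

text \<open>The spheres have to be nonempty here, as \<open>Max {}\<close> is an unspecified number.\<close>

lemma mean_nonneg: "0 \<le> mean p n f"
proof -
  obtain v where v: "v \<in> sphere_at n" using sphere_at_nonempty by blast
  have "0 \<le> cmod (f v)" by simp
  also have "\<dots> \<le> Max ((\<lambda>v. cmod (f v)) ` sphere_at n)"
    using v finite_sphere_at by (intro Max_ge) auto
  finally show ?thesis unfolding mean_def by simp
qed

lemma mean_cong_norm:
  assumes "\<And>v. v \<in> sphere_at n \<Longrightarrow> cmod (f v) = cmod (g v)"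
  shows "mean p n f = mean p n g"
proof -
  have "(\<lambda>v. cmod (f v)) ` sphere_at n = (\<lambda>v. cmod (g v)) ` sphere_at n"
    using assms by (intro image_cong) auto
  moreover have "n = 0 \<Longrightarrow> cmod (f r) = cmod (g r)"
    using assms sphere_at_0 by simp
  ultimately show ?thesis unfolding mean_def using assms by simp
qed

lemma mean_eq_0:
  assumes "0 < p" "mean p n f = 0" "v \<in> sphere_at n"
  shows "f v = 0"
proof (cases "n = 0 \<or> p = \<infinity>")
  case True
  have "cmod (f v) \<le> mean p n f"
    using True assms(3) finite_sphere_at sphere_at_0 unfolding mean_def by (auto intro: Max_ge)
  then show ?thesis using assms(2) by simp
next
  case False
  \<comment> \<open>The factor in front of the sum is nonzero because \<open>q \<ge> 1\<close>, so
    the sum itself vanishes.\<close>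
  then have "(\<Sum>v\<in>sphere_at n. cmod (f v) powr enn2real p) = 0"
    using assms(2) q_ge_1 unfolding mean_def by (auto simp: add_eq_0_iff)
  then show ?thesis
    using assms(3) finite_sphere_at by (simp add: sum_nonneg_eq_0_iff)
qed

text \<open>The constant modulus \<open>c\<close> factors out of all three formulas for the mean.
  The case \<open>c = 0\<close> handles vanishing functions, and
  \<open>c = 1 / mean p n (\<lambda>_. 1)\<close> produces mean 1.\<close>

lemma mean_radial:
  assumes "0 < p" "\<And>v. v \<in> sphere_at n \<Longrightarrow> cmod (f v) = c"
  shows "mean p n f = c * mean p n (\<lambda>_. 1)"
proof -
  have c: "0 \<le> c" using sphere_at_nonempty[of n] assms(2) norm_ge_zero by (metis ex_in_conv)
  consider "n = 0" | "n \<noteq> 0" "p = \<infinity>" | "n \<noteq> 0" "p \<noteq> \<infinity>" by blast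
  then show ?thesis
  proof cases
    case 1
    then show ?thesis using assms(2) sphere_at_0 unfolding mean_def by simp
  next
    case 2
    have "(\<lambda>v. cmod (f v)) ` sphere_at n = {c}" "(\<lambda>v. cmod 1) ` sphere_at n = {1}"
      using assms(2) sphere_at_nonempty[of n] by auto
    then show ?thesis using 2 unfolding mean_def by simp
  next
    case 3
    \<comment> \<open>The normalised size of the sphere; \<open>w powr (1 / enn2real p)\<close> is
      the mean of the constant 1.\<close>
    define w where "w = 1 / ((real q + 1) * real q ^ (n - 1)) * real (card (sphere_at n))"
    have w: "0 \<le> w" unfolding w_def by simp
    have p: "0 < enn2real p"
      using 3 assms(1) by (simp add: enn2real_positive_iff top.not_eq_extremum)
    have "mean p n f = (w * c powr enn2real p) powr (1 / enn2real p)"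
      using 3 assms(2) unfolding mean_def w_def by simp
    also have "\<dots> = c * w powr (1 / enn2real p)"
      using c w p by (simp add: powr_mult powr_powr)
    finally show ?thesis
      using 3 unfolding mean_def w_def by simp
  qed
qed

text \<open>For \<open>p \<ge> 1\<close> this is the triangle inequality for the means, by Minkowski
  or by maxima. For \<open>p < 1\<close> the p-th power of the mean is a weighted sum of p-th
  powers, each of them subadditive.\<close>

lemma mean_add:
  assumes "0 < p"
  shows "mean p n (\<lambda>v. f v + g v) powr gauge_exp p
         \<le> mean p n f powr gauge_exp p + mean p n g powr gauge_exp p"
proof -
  \<comment> \<open>Since the gauge exponent is at most 1, a plain triangle inequality for the means
    passes to the powers. This closes every case except \<open>p < 1\<close> with
    \<open>n \<noteq> 0\<close>.\<close>
  have le: "mean p n (\<lambda>v. f v + g v) powr gauge_exp p \<le> mean p n f powr gauge_exp p + mean p n g powr gauge_exp p"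
    if "mean p n (\<lambda>v. f v + g v) \<le> mean p n f + mean p n g"
  proof -
    have "mean p n (\<lambda>v. f v + g v) powr gauge_exp p \<le> (mean p n f + mean p n g) powr gauge_exp p"
      using that gauge_exp_bounds(1)[OF assms] mean_nonneg by (intro powr_mono2) auto
    also have "\<dots> \<le> mean p n f powr gauge_exp p + mean p n g powr gauge_exp p"
      using gauge_exp_bounds[of p] assms mean_nonneg by (intro powr_subadditive) auto
    finally show ?thesis .
  qed
  define w where "w = 1 / ((real q + 1) * real q ^ (n - 1))"
  have w: "0 \<le> w" unfolding w_def by simp
  let ?p = "enn2real p"
  have p: "0 < ?p" if "p \<noteq> \<infinity>"
    using that assms by (simp add: enn2real_positive_iff top.not_eq_extremum)
  consider "n = 0" | "n \<noteq> 0" "p = \<infinity>" | "n \<noteq> 0" "p \<noteq> \<infinity>" "1 \<le> p" | "n \<noteq> 0" "p \<noteq> \<infinity>" "\<not> 1 \<le> p"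
    by blast
  then show ?thesis
  proof cases
    case 1
    then show ?thesis by (intro le) (simp add: mean_def norm_triangle_ineq)
  next
    case 2
    have "cmod (f v + g v) \<le> Max ((\<lambda>v. cmod (f v)) ` sphere_at n) + Max ((\<lambda>v. cmod (g v)) ` sphere_at n)"
      if "v \<in> sphere_at n" for v
      using that finite_sphere_at
      by (intro order_trans[OF norm_triangle_ineq] add_mono Max_ge) auto
    then have "mean p n (\<lambda>v. f v + g v) \<le> mean p n f + mean p n g"
      using 2 finite_sphere_at sphere_at_nonempty unfolding mean_def by simp
    then show ?thesis by (rule le)
  next
    case 3
    have p1: "1 \<le> ?p" using 3 enn2real_mono[of 1 p] by (simp add: top.not_eq_extremum)
    have "(\<Sum>v\<in>sphere_at n. cmod (f v + g v) powr ?p) powr (1 / ?p)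
          \<le> (\<Sum>v\<in>sphere_at n. (cmod (f v) + cmod (g v)) powr ?p) powr (1 / ?p)"
      using p1 by (intro powr_mono2 sum_mono sum_nonneg) (auto intro: norm_triangle_ineq)
    also have "\<dots> \<le> (\<Sum>v\<in>sphere_at n. cmod (f v) powr ?p) powr (1 / ?p)
                   + (\<Sum>v\<in>sphere_at n. cmod (g v) powr ?p) powr (1 / ?p)"
      using p1 finite_sphere_at by (intro Minkowski_sum) auto
    finally have "w powr (1 / ?p) * (\<Sum>v\<in>sphere_at n. cmod (f v + g v) powr ?p) powr (1 / ?p)
        \<le> w powr (1 / ?p) * ((\<Sum>v\<in>sphere_at n. cmod (f v) powr ?p) powr (1 / ?p)
                   + (\<Sum>v\<in>sphere_at n. cmod (g v) powr ?p) powr (1 / ?p))"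
      by (rule mult_left_mono) simp
    then have "mean p n (\<lambda>v. f v + g v) \<le> mean p n f + mean p n g"
      using 3 w unfolding mean_def w_def[symmetric]
      by (simp add: powr_mult sum_nonneg distrib_left)
    then show ?thesis by (rule le)
  next
    case 4
    \<comment> \<open>For \<open>p < 1\<close> the gauge exponent is p itself and cancels the outer
      root.\<close>
    have powr_mean: "mean p n h powr ?p = w * (\<Sum>v\<in>sphere_at n. cmod (h v) powr ?p)" for h
      using 4 w p unfolding mean_def w_def[symmetric]
      by (simp add: powr_powr sum_nonneg)
    have p1: "?p \<le> 1" using gauge_exp_bounds(2)[of p] 4 by (simp add: gauge_exp_def)
    have "cmod (f v + g v) powr ?p \<le> cmod (f v) powr ?p + cmod (g v) powr ?p" for v
    proof -
      have "cmod (f v + g v) powr ?p \<le> (cmod (f v) + cmod (g v)) powr ?p"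
        using p 4 by (intro powr_mono2 norm_triangle_ineq) auto
      also have "\<dots> \<le> cmod (f v) powr ?p + cmod (g v) powr ?p"
        using p p1 4 by (intro powr_subadditive) auto
      finally show ?thesis .
    qed
    then have "w * (\<Sum>v\<in>sphere_at n. cmod (f v + g v) powr ?p)
      \<le> w * (\<Sum>v\<in>sphere_at n. cmod (f v) powr ?p + cmod (g v) powr ?p)"
      using w by (intro mult_left_mono sum_mono)
    then show ?thesis
      using 4 unfolding gauge_exp_def by (simp add: powr_mean sum.distrib distrib_left)
  qed
qed

section \<open>The supremum of the means\<close>

lemma mean_le_Tnorm:
  assumes "Tnorm p f < \<infinity>"
  shows "mean p n f \<le> enn2real (Tnorm p f)"
proof -
  have "ennreal (mean p n f) \<le> Tnorm p f"
    unfolding Tnorm_def by (rule SUP_upper) simp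
  \<comment> \<open>Finiteness matters here, since \<open>enn2real \<infinity> = 0\<close>.\<close>
  then show ?thesis
    using enn2real_mono[of "ennreal (mean p n f)"] assms mean_nonneg by simp
qed

lemma Tnorm_le:
  assumes "\<And>n. mean p n f \<le> c"
  shows "Tnorm p f \<le> ennreal c"
  unfolding Tnorm_def using assms by (intro SUP_least ennreal_leI)

text \<open>By \<open>mean_add\<close>, the number \<open>c powr (1 / ?s)\<close> bounds all means
  of the sum at once. It yields finiteness, and its power \<open>c\<close> is the required
  bound.\<close>

lemma Tnorm_add:
  assumes "0 < p" "Tnorm p f < \<infinity>" "Tnorm p g < \<infinity>"
  shows "Tnorm p (\<lambda>v. f v + g v) < \<infinity>"
    and "enn2real (Tnorm p (\<lambda>v. f v + g v)) powr gauge_exp p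
         \<le> enn2real (Tnorm p f) powr gauge_exp p + enn2real (Tnorm p g) powr gauge_exp p"
proof -
  let ?s = "gauge_exp p"
  define c where "c = enn2real (Tnorm p f) powr ?s + enn2real (Tnorm p g) powr ?s"
  have s: "0 < ?s" using assms gauge_exp_bounds by blast
  have c: "0 \<le> c" unfolding c_def by simp
  have "mean p n (\<lambda>v. f v + g v) \<le> c powr (1 / ?s)" for n
  proof -
    have "mean p n (\<lambda>v. f v + g v) powr ?s \<le> mean p n f powr ?s + mean p n g powr ?s"
      by (rule mean_add[OF assms(1)])
    also have "\<dots> \<le> c"
      unfolding c_def using s assms mean_le_Tnorm mean_nonneg
      by (intro add_mono powr_mono2) auto
    finally have "(mean p n (\<lambda>v. f v + g v) powr ?s) powr (1 / ?s) \<le> c powr (1 / ?s)"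
      using s by (intro powr_mono2) auto
    then show ?thesis using s mean_nonneg by (simp add: powr_powr)
  qed
  then have T: "Tnorm p (\<lambda>v. f v + g v) \<le> ennreal (c powr (1 / ?s))"
    by (rule Tnorm_le)
  then show "Tnorm p (\<lambda>v. f v + g v) < \<infinity>"
    using order_le_less_trans by fastforce
  have "enn2real (Tnorm p (\<lambda>v. f v + g v)) \<le> c powr (1 / ?s)"
    using enn2real_mono[OF T] by simp
  then have "enn2real (Tnorm p (\<lambda>v. f v + g v)) powr ?s \<le> (c powr (1 / ?s)) powr ?s"
    using s by (intro powr_mono2) auto
  then show "enn2real (Tnorm p (\<lambda>v. f v + g v)) powr ?s
      \<le> enn2real (Tnorm p f) powr ?s + enn2real (Tnorm p g) powr ?s"
    using s c unfolding c_def[symmetric] by (simp add: powr_powr)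
qed

text \<open>Only moduli enter the means. Applied to a function and its negative, this gives
  finiteness for differences and symmetry of the metric.\<close>

lemma Tnorm_cong_norm:
  assumes "\<And>v. v \<in> V \<Longrightarrow> cmod (f v) = cmod (g v)"
  shows "Tnorm p f = Tnorm p g"
  unfolding Tnorm_def using assms
  by (intro SUP_cong refl arg_cong[where f = ennreal] mean_cong_norm) (auto simp: sphere_at_def)

section \<open>The metric on the space\<close>

lemma Tdist_eq: "Tdist p f g = enn2real (Tnorm p (\<lambda>v. f v - g v)) powr gauge_exp p"
  unfolding Tdist_def gauge_exp_def by simp

lemma Tnorm_diff_finite:
  assumes "0 < p" "f \<in> Tspace p" "g \<in> Tspace p"
  shows "Tnorm p (\<lambda>v. f v - g v) < \<infinity>"
proof -
  have "Tnorm p (\<lambda>v. - g v) < \<infinity>"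
    using assms(3) Tnorm_cong_norm[of "\<lambda>v. - g v" g p] unfolding Tspace_def by simp
  then show ?thesis
    using Tnorm_add(1)[of p f "\<lambda>v. - g v"] assms unfolding Tspace_def by simp
qed

lemma Metric_space_Tdist:
  assumes p: "0 < p"
  shows "Metric_space (Tspace p) (Tdist p)"
proof
  show "0 \<le> Tdist p f g" for f g
    by (simp add: Tdist_eq)
  show "Tdist p f g = Tdist p g f" for f g
    using Tnorm_cong_norm[of "\<lambda>v. f v - g v" "\<lambda>v. g v - f v" p]
    by (simp add: Tdist_eq norm_minus_commute)
  show "Tdist p f g = 0 \<longleftrightarrow> f = g" if fg: "f \<in> Tspace p" "g \<in> Tspace p" for f g
  proof
    assume "Tdist p f g = 0"
    then have "mean p n (\<lambda>v. f v - g v) = 0" for n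
      using mean_le_Tnorm[OF Tnorm_diff_finite[OF p fg], of n] mean_nonneg
      by (simp add: Tdist_eq antisym)
    \<comment> \<open>Every vertex lies on the sphere of its own level, so vanishing means force
      agreement on \<open>V\<close>; extensionality settles the values elsewhere.\<close>
    then have "f v - g v = 0" if "v \<in> V" for v
      using mean_eq_0[OF p, of "level v" "\<lambda>v. f v - g v" v] that unfolding sphere_at_def by simp
    then show "f = g"
      using fg unfolding Tspace_def by (intro extensionalityI[of f V g]) auto
  next
    assume "f = g"
    then have "mean p n (\<lambda>v. f v - g v) = 0" for n
      using mean_radial[OF p, of n "\<lambda>v. f v - g v" 0] by simp
    then have "Tnorm p (\<lambda>v. f v - g v) = 0"
      unfolding Tnorm_def by simp
    then show "Tdist p f g = 0" by (simp add: Tdist_eq)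
  qed
  show "Tdist p f h \<le> Tdist p f g + Tdist p g h"
    if "f \<in> Tspace p" "g \<in> Tspace p" "h \<in> Tspace p" for f g h
    using Tnorm_add(2)[OF p Tnorm_diff_finite[OF p that(1,2)] Tnorm_diff_finite[OF p that(2,3)]]
    by (simp add: Tdist_eq)
qed

section \<open>The uncountable separated family\<close>

definition level_function :: "ennreal \<Rightarrow> nat set \<Rightarrow> 'v \<Rightarrow> complex" where
  "level_function p S = restrict
     (\<lambda>v. if level v \<in> S then of_real (1 / mean p (level v) (\<lambda>_. 1)) else 0) V"

text \<open>A zero mean would make the constant 1 vanish on a nonempty sphere. This justifies the
  division in \<open>level_function\<close>.\<close>

lemma mean_1_pos:
  assumes "0 < p"
  shows "0 < mean p n (\<lambda>_. 1)"
  using mean_eq_0[OF assms, of n "\<lambda>_. 1"] mean_nonneg[of p n "\<lambda>_. 1"] sphere_at_nonempty[of n]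
  by (force simp: less_le)

lemma mean_level:
  assumes "0 < p" "\<And>v. v \<in> sphere_at n \<Longrightarrow> cmod (f v) = 1 / mean p n (\<lambda>_. 1)"
  shows "mean p n f = 1"
  using mean_radial[OF assms] mean_1_pos[OF assms(1), of n] by simp

text \<open>The mean on a sphere is 1 if its level is in \<open>S\<close> and 0 otherwise, so the
  supremum is at most 1.\<close>

lemma level_function_in_Tspace:
  assumes p: "0 < p"
  shows "level_function p S \<in> Tspace p"
proof -
  have "mean p n (level_function p S) \<le> 1" for n
  proof (cases "n \<in> S")
    case True
    then show ?thesis
      using mean_level[OF p, of n "level_function p S"]
      unfolding level_function_def sphere_at_def by (simp add: norm_divide mean_nonneg)
  next
    case False
    then show ?thesis
      using mean_radial[OF p, of n "level_function p S" 0]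
      unfolding level_function_def sphere_at_def by simp
  qed
  then have "Tnorm p (level_function p S) \<le> ennreal 1"
    by (rule Tnorm_le)
  then show ?thesis
    unfolding Tspace_def level_function_def using order_le_less_trans by fastforce
qed

text \<open>On a level belonging to exactly one of \<open>S\<close> and \<open>T\<close>, the
  difference has the modulus of the nonzero function, hence mean 1. The bound 1 survives the
  positive gauge exponent.\<close>

lemma Tdist_level_function:
  assumes p: "0 < p" and "S \<noteq> T"
  shows "1 \<le> Tdist p (level_function p S) (level_function p T)"
proof -
  obtain n where n: "n \<in> S \<longleftrightarrow> n \<notin> T" using assms(2) by blast
  have "mean p n (\<lambda>v. level_function p S v - level_function p T v) = 1"
    using n by (intro mean_level[OF p])
      (auto simp: level_function_def sphere_at_def norm_divide mean_nonneg)
  then have "1 \<le> enn2real (Tnorm p (\<lambda>v. level_function p S v - level_function p T v))"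
    using mean_le_Tnorm[OF Tnorm_diff_finite] level_function_in_Tspace p by metis
  then show ?thesis
    using gauge_exp_bounds(1)[OF p] unfolding Tdist_eq by (intro ge_one_powr_ge_zero) auto
qed

end

theorem theorem5:
  fixes V :: "'v set" and E :: "'v set set" and r :: 'v and q :: nat and p :: ennreal
  assumes "q \<ge> 1"
    and "rooted_homogeneous_tree V E r q"
    and "infinite V"
    and "0 < p"
  shows "\<not> separable_space (rooted_homogeneous_tree.Ttopology V E r q p)"
proof -
  interpret rooted_homogeneous_tree V E r q by fact
  interpret infinite_rooted_homogeneous_tree V E r q by unfold_locales fact+
  interpret Metric_space "Tspace p" "Tdist p" by (rule Metric_space_Tdist[OF assms(4)])
  show ?thesis
    \<comment> \<open>The family is indexed by the uncountable type \<open>nat set\<close>, with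
      separation constant 1.\<close>
    unfolding Ttopology_def
    using level_function_in_Tspace[OF assms(4)] Tdist_level_function[OF assms(4)]
    by (intro separated_imp_not_separable[of "level_function p" 1] uncountable_UNIV_nat_set) auto
qed

end
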